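(* Let $P$ be an $N\times N$ real matrix with non-negative entries and spectral radius $\rho(P)<1$, let $B\in\mathbb{R}^N$, and let $\mathcal{I}=\{i_1,i_2,\dots\}$ be any fair sequence of elements of $\{1,\dots,N\}$. Then the D-iteration history vectors $H_n(P,B,\mathcal{I})$ converge, as $n\to\infty$, to the unique vector $X\in\mathbb{R}^N$ such that $X=PX+B$.
   Context: Let $\Omega=\{1,\dots,N\}$, let $I$ be the $N\times N$ identity matrix, and for $i\in\Omega$ let $J_i$ be the $N\times N$ matrix whose only non-zero entry is $(J_i)_{ii}=1$. The diffusion operators of $P$ are $P_i=I-J_i+PJ_i$. Given a sequence $\mathcal{I}=\{i_1,i_2,\dots\}$ in $\Omega$, the D-iteration is defined by $F_0=B$, $H_0=0$ and, for $n\ge1$, $F_n=P_{i_n}F_{n-1}$ and $H_n=H_{n-1}+J_{i_n}F_{n-1}$; one writes $H_n=H_n(P,B,\mathcal{I})$. The sequence $\mathcal{I}$ is fair if every $i\in\Omega$ occurs infinitely often in it. *)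

theory Defs
  imports "HOL-Analysis.Analysis"
begin

definition complex_eigenvalues :: "real^'n^'n \<Rightarrow> complex set" where
  "complex_eigenvalues A =
     {\<mu>. \<exists>v. v \<noteq> 0 \<and> map_matrix complex_of_real A *v v = \<mu> *s v}"

text \<open>The set of eigenvalues of a square matrix is finite and non-empty (a type of class
  \<^class>\<open>finite\<close> has at least one element), so the maximum is meaningful.\<close>

definition spec_radius :: "real^'n^'n \<Rightarrow> real" where
  "spec_radius A = Max (cmod ` complex_eigenvalues A)"

definition unit_diag :: "'n \<Rightarrow> real^'n^'n" where
  "unit_diag i = (\<chi> k l. if k = i \<and> l = i then 1 else 0)"

definition diffusion_op :: "real^'n^'n \<Rightarrow> 'n \<Rightarrow> real^'n^'n" where
  "diffusion_op P i = mat 1 - unit_diag i + P ** unit_diag i"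

text \<open>Sequences of indices are functions \<open>s\<close> on \<^typ>\<open>nat\<close> read from index 1 on:
  the value \<open>s 0\<close> plays no role in the iteration or in fairness.\<close>

primrec fluid :: "real^'n^'n \<Rightarrow> real^'n \<Rightarrow> (nat \<Rightarrow> 'n) \<Rightarrow> nat \<Rightarrow> real^'n" where
  "fluid P B s 0 = B"
| "fluid P B s (Suc n) = diffusion_op P (s (Suc n)) *v fluid P B s n"

primrec history :: "real^'n^'n \<Rightarrow> real^'n \<Rightarrow> (nat \<Rightarrow> 'n) \<Rightarrow> nat \<Rightarrow> real^'n" where
  "history P B s 0 = 0"
| "history P B s (Suc n) = history P B s n + unit_diag (s (Suc n)) *v fluid P B s n"

definition fair_seq :: "(nat \<Rightarrow> 'n) \<Rightarrow> bool" where
  "fair_seq s \<longleftrightarrow> (\<forall>i. infinite {n. n \<ge> 1 \<and> s n = i})"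

end

theory Submission
  imports Defs "HOL-Computational_Algebra.Polynomial"
begin

text \<open>
  Read coordinatewise, one step of the D-iteration with index \<open>i\<close> overwrites the \<open>i\<close>-th entry of the
  history \<open>H\<close> by the \<open>i\<close>-th entry of \<open>P H + B\<close> (lemma \<open>history_Suc_nth\<close>): the fluid is always the
  residual \<open>B + P H - H\<close>. The D-iteration is thus an asynchronous fixed point iteration for the map
  \<open>H \<mapsto> P H + B\<close>, which is monotone because \<open>P\<close> is non-negative.

  If \<open>B \<ge> 0\<close>, the history starts below its first update, so it increases; and it stays below
  every non-negative solution \<open>X\<close> of \<open>X = P X + B\<close>. Hence it converges, and fairness, which updates
  every coordinate infinitely often, forces the limit to be a fixed point
  (lemma \<open>history_tendsto_of_nonneg\<close>). The history is linear in \<open>B\<close>, and every \<open>B\<close> is a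
  difference of two entrywise positive vectors, so non-negative solutions for positive right-hand
  sides and uniqueness of solutions suffice.

  Both come from the spectral hypothesis in the weak form that \<open>I - t P\<close> is invertible for
  \<open>0 \<le> t \<le> 1\<close>: otherwise \<open>1/t \<ge> 1\<close> would be an eigenvalue of \<open>P\<close>. Uniqueness is the case
  \<open>t = 1\<close>. For existence (lemma \<open>exists_nonneg_solution\<close>), let \<open>C > 0\<close> and let \<open>x(t)\<close> solve
  \<open>x = t P x + C\<close>. If \<open>x(t) \<ge> 0\<close>, then \<open>x(t) \<ge> C > 0\<close>, so along the continuous path from
  \<open>x(0) = C\<close> to \<open>x(1)\<close> no entry can ever become negative.
\<close>

section \<open>Eigenvalues and the spectral radius\<close>

lemma det_eq_0_iff_kernel:
  fixes A :: "'a::field^'n^'n"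
  shows "det A = 0 \<longleftrightarrow> (\<exists>v. v \<noteq> 0 \<and> A *v v = 0)"
  by (metis invertible_det_nz invertible_left_inverse matrix_left_invertible_ker)

lemma poly_det:
  fixes M :: "'a::comm_ring_1 poly^'n^'n"
  shows "poly (det M) x = det (\<chi> i j. poly (M $ i $ j) x)"
  by (simp add: det_def poly_sum poly_prod)

text \<open>The reversed characteristic polynomial \<open>det (I - t A)\<close> takes the value \<open>1\<close> at \<open>0\<close>, so it has
  finitely many roots, and the inverse of a non-zero eigenvalue is one of them.\<close>

lemma finite_eigenvalues:
  fixes A :: "'a::field^'n^'n"
  shows "finite {\<mu>. \<exists>v. v \<noteq> 0 \<and> A *v v = \<mu> *s v}"
proof -
  define M where "M = (\<chi> i j. [: if i = j then 1 else 0, - (A $ i $ j) :])"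
  have eval: "poly (det M) t = det (mat 1 - (\<chi> i j. t * A $ i $ j))" for t
    unfolding poly_det
    by (rule arg_cong[where f = det]) (simp add: M_def vec_eq_iff mat_def)
  have "poly (det M) 0 = 1"
    by (simp add: eval zero_vec_def[symmetric])
  then have "finite {t. poly (det M) t = 0}"
    by (intro poly_roots_finite) auto
  moreover have "{\<mu>. \<exists>v. v \<noteq> 0 \<and> A *v v = \<mu> *s v}
      \<subseteq> insert 0 (inverse ` {t. poly (det M) t = 0})"
  proof clarify
    fix \<mu> v
    assume v: "v \<noteq> 0" "A *v v = \<mu> *s v" and \<mu>: "\<mu> \<notin> inverse ` {t. poly (det M) t = 0}"
    have "poly (det M) (inverse \<mu>) = 0" if "\<mu> \<noteq> 0"
    proof -
      have "(\<chi> i j. inverse \<mu> * A $ i $ j) *v v = inverse \<mu> *s (A *v v)"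
        by (simp add: vec_eq_iff matrix_vector_mult_def sum_distrib_left mult.assoc)
      also have "\<dots> = v"
        using v that by simp
      finally have "(mat 1 - (\<chi> i j. inverse \<mu> * A $ i $ j)) *v v = 0"
        by (simp add: matrix_vector_mult_diff_rdistrib)
      then show ?thesis
        using v det_eq_0_iff_kernel eval by metis
    qed
    then show "\<mu> = 0"
      using \<mu> by (metis (mono_tags) image_eqI inverse_inverse_eq mem_Collect_eq)
  qed
  ultimately show ?thesis
    by (meson finite_imageI finite_insert finite_subset)
qed

lemma abs_eigenvalue_le_spec_radius:
  fixes A :: "real^'n^'n"
  assumes "v \<noteq> 0" "A *v v = \<mu> *s v"
  shows "\<bar>\<mu>\<bar> \<le> spec_radius A"
proof -
  define w :: "complex^'n" where "w = (\<chi> i. complex_of_real (v $ i))"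
  have "w \<noteq> 0"
    using assms(1) by (auto simp: w_def vec_eq_iff)
  moreover have "map_matrix complex_of_real A *v w = complex_of_real \<mu> *s w"
  proof -
    have "(\<Sum>j\<in>UNIV. A $ i $ j * v $ j) = \<mu> * v $ i" for i
      using assms(2) by (simp add: vec_eq_iff matrix_vector_mult_def)
    then show ?thesis
      by (simp add: w_def vec_eq_iff matrix_vector_mult_def flip: of_real_mult of_real_sum)
  qed
  ultimately have "complex_of_real \<mu> \<in> complex_eigenvalues A"
    unfolding complex_eigenvalues_def by blast
  moreover have "finite (cmod ` complex_eigenvalues A)"
    unfolding complex_eigenvalues_def by (intro finite_imageI finite_eigenvalues)
  ultimately show ?thesis
    unfolding spec_radius_def by (metis Max_ge imageI norm_of_real)
qed

lemma det_id_minus_scaled_nonzero: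
  fixes P :: "real^'n^'n"
  assumes "spec_radius P < 1" "0 \<le> t" "t \<le> 1"
  shows "det (mat 1 - t *\<^sub>R P) \<noteq> 0"
proof
  assume "det (mat 1 - t *\<^sub>R P) = 0"
  then obtain v where v: "v \<noteq> 0" "(mat 1 - t *\<^sub>R P) *v v = 0"
    using det_eq_0_iff_kernel by blast
  then have eq: "v = t *\<^sub>R (P *v v)"
    by (simp add: matrix_vector_mult_diff_rdistrib scaleR_matrix_vector_assoc)
  with v have "t \<noteq> 0" by auto
  then have "P *v v = inverse t *\<^sub>R v"
    by (metis eq scaleR_one scaleR_scaleR left_inverse)
  then have "P *v v = inverse t *s v"
    by (simp add: scalar_mult_eq_scaleR)
  from abs_eigenvalue_le_spec_radius[OF v(1) this] have "inverse t < 1"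
    using assms(1) by linarith
  moreover have "1 \<le> inverse t"
    using assms \<open>t \<noteq> 0\<close> by (simp add: one_le_inverse)
  ultimately show False by simp
qed

section \<open>Solutions of the fixed point equation\<close>

lemma fixed_point_unique:
  fixes P :: "real^'n^'n"
  assumes "spec_radius P < 1" "X = P *v X + B" "Y = P *v Y + B"
  shows "Y = X"
proof -
  have "(mat 1 - 1 *\<^sub>R P) *v (Y - X) = (Y - P *v Y) - (X - P *v X)"
    by (simp add: matrix_vector_mult_diff_rdistrib matrix_vector_mult_diff_distrib)
  also have "\<dots> = B - B"
    using assms(2,3) by (metis add_diff_cancel_left')
  finally have "(mat 1 - 1 *\<^sub>R P) *v (Y - X) = 0"
    by simp
  then have "Y - X = 0"
    using det_id_minus_scaled_nonzero[OF assms(1), of 1] det_eq_0_iff_kernel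
    by (metis order_refl zero_le_one)
  then show ?thesis by simp
qed

lemma matrix_vector_mult_mono:
  fixes P :: "real^'n^'m"
  assumes "\<forall>i j. P $ i $ j \<ge> 0" "\<And>j. x $ j \<le> y $ j"
  shows "(P *v x) $ i \<le> (P *v y) $ i"
  unfolding matrix_vector_mult_def
  by (simp add: assms sum_mono mult_left_mono)

lemma continuous_on_det:
  fixes f :: "'a::topological_space \<Rightarrow> real^'n^'n"
  assumes "\<And>i j. continuous_on S (\<lambda>x. f x $ i $ j)"
  shows "continuous_on S (\<lambda>x. det (f x))"
  unfolding det_def by (intro continuous_intros assms)

text \<open>The set of parameters \<open>t\<close> at which the solution of \<open>x = t P x + C\<close> is non-negative is
  closed in \<open>[0,1]\<close>. A non-negative solution is bounded below by \<open>C\<close>, so it is even positive, and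
  hence the set is also open in \<open>[0,1]\<close>; it contains \<open>0\<close>, so it contains \<open>1\<close>.\<close>

lemma exists_nonneg_solution:
  fixes P :: "real^'n^'n" and C :: "real^'n"
  assumes P: "\<forall>i j. P $ i $ j \<ge> 0" and rho: "spec_radius P < 1" and C: "\<And>i. C $ i > 0"
  shows "\<exists>X. X = P *v X + C \<and> (\<forall>i. X $ i \<ge> 0)"
proof -
  let ?A = "\<lambda>t. mat 1 - t *\<^sub>R P"
  \<comment> \<open>Cramer's rule makes the dependence of the solution on \<open>t\<close> visibly continuous.\<close>
  define x where
    "x t = (\<chi> k. det (\<chi> i j. if j = k then C $ i else ?A t $ i $ j) / det (?A t))" for t
  have det: "det (?A t) \<noteq> 0" if "t \<in> {0..1}" for t
    using det_id_minus_scaled_nonzero[OF rho] that by auto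
  have x_eq: "x t = t *\<^sub>R (P *v x t) + C" if "t \<in> {0..1}" for t
  proof -
    have "?A t *v x t = C"
      using cramer[OF det[OF that], of "x t" C] by (simp add: x_def)
    then show ?thesis
      by (simp add: matrix_vector_mult_diff_rdistrib scaleR_matrix_vector_assoc diff_eq_eq
          add.commute)
  qed
  have cont: "continuous_on {0..1} x"
    unfolding x_def
  proof (intro continuous_on_vec_lambda continuous_on_divide continuous_on_det ballI)
    fix i j k
    show "continuous_on {0..1} (\<lambda>t. ?A t $ i $ j)"
      by simp (intro continuous_intros)
    then show "continuous_on {0..1}
        (\<lambda>t. (\<chi> i j. if j = k then C $ i else ?A t $ i $ j) $ i $ j)"
      by (cases "j = k") simp_all
  qed (use det in auto)
  define S where "S = {0..1} \<inter> x -` {y. \<forall>i. 0 \<le> y $ i}"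
  have pos: "0 < x t $ i" if "t \<in> S" for t i
  proof -
    have t: "t \<in> {0..1}" "\<And>i. 0 \<le> x t $ i"
      using that by (auto simp: S_def)
    have "0 \<le> (P *v x t) $ i"
      using matrix_vector_mult_mono[OF P, of 0 "x t" i] t(2) by simp
    then have "0 \<le> t * (P *v x t) $ i"
      using t(1) by simp
    moreover have "x t $ i = t * (P *v x t) $ i + C $ i"
      by (subst x_eq[OF t(1)]) simp
    ultimately show ?thesis
      using C[of i] by linarith
  qed
  then have S_open: "S = {0..1} \<inter> x -` {y. \<forall>i. 0 < y $ i}"
    by (auto simp: S_def intro: less_imp_le)
  have "closed {y :: real^'n. \<forall>i. 0 \<le> y $ i}"
    by (intro closed_Collect_all closed_Collect_le continuous_intros)
  then have "closedin (top_of_set {0..1}) S"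
    unfolding S_def by (rule continuous_closedin_preimage[OF cont])
  moreover have "open (\<Inter>i. {y :: real^'n. 0 < y $ i})"
    by (intro open_INT ballI open_Collect_less continuous_intros) auto
  then have "openin (top_of_set {0..1}) S"
    unfolding S_open by (intro continuous_openin_preimage_gen[OF cont]) (simp add: Collect_all_eq)
  moreover have "0 \<in> S"
    using x_eq[of 0] C by (auto simp: S_def intro: less_imp_le)
  ultimately have "S = {0..1}"
    using connected_clopen[of "{0..1::real}"] by auto
  then have "1 \<in> S" by simp
  then have "\<forall>i. x 1 $ i \<ge> 0" by (simp add: S_def)
  moreover have "x 1 = P *v x 1 + C"
    by (subst x_eq) simp_all
  ultimately show ?thesis by blast
qed

section \<open>The D-iteration as an asynchronous fixed point iteration\<close>

lemma unit_diag_mult_nth: "(unit_diag i *v v) $ k = (if k = i then v $ k else 0)"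
proof -
  have "(unit_diag i *v v) $ k = (\<Sum>l\<in>UNIV. if l = i then (if k = i then v $ i else 0) else 0)"
    unfolding matrix_vector_mult_def unit_diag_def vec_lambda_beta
    by (intro sum.cong) auto
  then show ?thesis by simp
qed

lemma fluid_eq_residual: "fluid P B s n = B + P *v history P B s n - history P B s n"
  by (induction n)
    (simp_all add: diffusion_op_def matrix_vector_mult_diff_rdistrib
      matrix_vector_mult_add_rdistrib matrix_vector_right_distrib matrix_vector_mul_assoc)

lemma history_Suc_nth:
  "history P B s (Suc n) $ i =
     (if i = s (Suc n) then (P *v history P B s n + B) $ i else history P B s n $ i)"
  by (simp add: unit_diag_mult_nth fluid_eq_residual)

lemma fluid_diff: "fluid P (B - C) s n = fluid P B s n - fluid P C s n"
  by (induction n) (simp_all add: matrix_vector_mult_diff_distrib)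

lemma history_diff: "history P (B - C) s n = history P B s n - history P C s n"
  by (induction n) (simp_all add: fluid_diff matrix_vector_mult_diff_distrib)

text \<open>The inequality \<open>H \<le> P H + B\<close> (the fluid stays non-negative) makes the update of a coordinate
  an increase, and it is kept by monotonicity of \<open>P\<close>.\<close>

lemma history_le_update:
  assumes P: "\<forall>i j. P $ i $ j \<ge> 0" and B: "\<And>i. B $ i \<ge> 0"
  shows "history P B s n $ i \<le> (P *v history P B s n + B) $ i"
proof (induction n arbitrary: i)
  case 0
  then show ?case by (simp add: B)
next
  case (Suc n)
  have le: "history P B s n $ j \<le> history P B s (Suc n) $ j" for j
    unfolding history_Suc_nth using Suc.IH by auto
  have "history P B s (Suc n) $ i \<le> (P *v history P B s n + B) $ i"
    unfolding history_Suc_nth using Suc.IH by auto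
  also have "\<dots> \<le> (P *v history P B s (Suc n) + B) $ i"
    using matrix_vector_mult_mono[OF P le] by (simp del: history.simps)
  finally show ?case .
qed

lemma history_le_fixed_point:
  assumes P: "\<forall>i j. P $ i $ j \<ge> 0" and X: "X = P *v X + B" "\<And>i. X $ i \<ge> 0"
  shows "history P B s n $ i \<le> X $ i"
proof (induction n arbitrary: i)
  case 0
  then show ?case by (simp add: X(2))
next
  case (Suc n)
  have "(P *v history P B s n + B) $ i \<le> (P *v X + B) $ i"
    using matrix_vector_mult_mono[OF P Suc.IH] by simp
  then show ?case
    unfolding history_Suc_nth using Suc.IH X(1) by metis
qed

text \<open>The increasing bounded history has a limit \<open>L\<close>. Along the times just after the updates of a
  coordinate \<open>i\<close>, the \<open>i\<close>-th entries of \<open>H\<close> at one time and of \<open>P H + B\<close> at the time before agree;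
  there are infinitely many such times by fairness, so the limits agree: \<open>L = P L + B\<close>.\<close>

lemma history_tendsto_of_nonneg:
  assumes P: "\<forall>i j. P $ i $ j \<ge> 0" and rho: "spec_radius P < 1" and fair: "fair_seq s"
    and B: "\<And>i. B $ i \<ge> 0" and X: "X = P *v X + B" "\<And>i. X $ i \<ge> 0"
  shows "history P B s \<longlonglongrightarrow> X"
proof -
  let ?H = "history P B s"
  have "incseq (\<lambda>n. ?H n $ i)" for i
  proof (rule incseq_SucI)
    show "?H n $ i \<le> ?H (Suc n) $ i" for n
      unfolding history_Suc_nth using history_le_update[OF P B] by auto
  qed
  then have "\<exists>l. (\<lambda>n. ?H n $ i) \<longlonglongrightarrow> l" for i
    using incseq_convergent[of "\<lambda>n. ?H n $ i" "X $ i"] history_le_fixed_point[OF P X] by metis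
  then obtain l where l: "\<And>i. (\<lambda>n. ?H n $ i) \<longlonglongrightarrow> l i"
    by metis
  define L where "L = (\<chi> i. l i)"
  have HL: "?H \<longlonglongrightarrow> L"
    by (rule vec_tendstoI) (simp add: L_def l)
  have "L $ i = (P *v L + B) $ i" for i
  proof -
    define D where "D n = ?H (Suc n) $ i - (P *v ?H n + B) $ i" for n
    have "D \<longlonglongrightarrow> L $ i - (P *v L + B) $ i"
      unfolding D_def
      by (intro tendsto_intros LIMSEQ_Suc[OF HL]
          bounded_linear.tendsto[OF matrix_vector_mul_bounded_linear] HL)
    moreover have "\<exists>\<^sub>F n in sequentially. D n = 0"
    proof -
      have "\<exists>n\<ge>m. s (Suc n) = i" for m
      proof -
        have "infinite {n. n \<ge> 1 \<and> s n = i}"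
          using fair by (simp add: fair_seq_def)
        then obtain n where "n > m" "s n = i"
          unfolding infinite_nat_iff_unbounded by blast
        then show ?thesis
          by (metis Suc_le_D Suc_le_eq Suc_le_mono)
      qed
      moreover have "D n = 0" if "s (Suc n) = i" for n
        unfolding D_def history_Suc_nth using that by simp
      ultimately show ?thesis
        unfolding frequently_sequentially by blast
    qed
    ultimately have "L $ i - (P *v L + B) $ i = 0"
      using tendsto_imp_eventually_ne unfolding frequently_def by blast
    then show ?thesis by simp
  qed
  then have "L = P *v L + B"
    by (simp add: vec_eq_iff)
  with HL show ?thesis
    using fixed_point_unique[OF rho X(1)] by metis
qed

theorem theorem4:
  fixes P :: "real^'n^'n" and B :: "real^'n" and s :: "nat \<Rightarrow> 'n"
  assumes "\<forall>i j. (P $ i) $ j \<ge> 0"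
    and "spec_radius P < 1"
    and "fair_seq s"
  shows "\<exists>X. X = P *v X + B \<and> (\<forall>Y. Y = P *v Y + B \<longrightarrow> Y = X)
           \<and> history P B s \<longlonglongrightarrow> X"
proof -
  have pos: "\<exists>Z. Z = P *v Z + C \<and> history P C s \<longlonglongrightarrow> Z" if C: "\<And>i. C $ i > 0" for C
    using exists_nonneg_solution[OF assms(1,2) C]
      history_tendsto_of_nonneg[OF assms, of C] less_imp_le[OF C] by metis
  define C where "C = (\<chi> i. \<bar>B $ i\<bar> + 1)"
  have "C $ i > 0" "(C - B) $ i > 0" for i
    by (auto simp: C_def)
  then obtain Z W where Z: "Z = P *v Z + C" "history P C s \<longlonglongrightarrow> Z"
    and W: "W = P *v W + (C - B)" "history P (C - B) s \<longlonglongrightarrow> W"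
    using pos by metis
  have "Z - W = (P *v Z + C) - (P *v W + (C - B))"
    using Z(1) W(1) by metis
  also have "\<dots> = P *v (Z - W) + B"
    by (simp add: matrix_vector_mult_diff_distrib)
  finally have X: "Z - W = P *v (Z - W) + B" .
  have "history P B s n = history P C s n - history P (C - B) s n" for n
    using history_diff[of P C "C - B" s n] by simp
  then have "history P B s \<longlonglongrightarrow> Z - W"
    using tendsto_diff[OF Z(2) W(2)] by presburger
  with X show ?thesis
    using fixed_point_unique[OF assms(2) X] by blast
qed

end
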